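(* Let $p$ be an odd prime and $n>3$ an odd integer such that $n+1\neq 2l_1p$ for every positive integer $l_1$ and $n\neq p^{l_2}$ for every positive integer $l_2$. Let $$f_{n,1}(x)=\sum_{j\geq 0}\binom{n-1}{2j+1}(x^j-x^{j+1})+2\sum_{j\geq 0}\binom{n}{2j}x^j\in\mathbb{F}_p[x],\qquad C_n(x):=f_{n,1}(x)-(n+1)x^{(n-1)/2}.$$ Then, with $N=(n-1)/2$, $C_n(x)$ viewed as an element of $\mathbb{F}_p[x]/(x^N-1)$ is a coterm polynomial.
   Context: Coefficients are reduced modulo $p$; binomial coefficients $\binom{a}{b}$ are $0$ when $b>a$. For a commutative ring $R$ with identity and $N\ge1$, a polynomial $a_0+a_1x+\cdots+a_{N-1}x^{N-1}\in R[x]/(x^N-1)$ is a coterm polynomial if $a_i=a_{N-i}$ for all $1\le i\le\lfloor N/2\rfloor$. *)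

theory Defs
  imports "HOL-Computational_Algebra.Polynomial" "Berlekamp_Zassenhaus.Finite_Field"
begin

text \<open>The ring \<open>R[x]/(x\<^sup>N - 1)\<close> is rendered as the set of congruence classes
  \<open>UNIV // cyc_rel N\<close>, where \<open>R\<close> is any type of class \<open>comm_ring_1\<close>.\<close>

definition cyc_rel :: "nat \<Rightarrow> ('a::comm_ring_1 poly \<times> 'a poly) set" where
  "cyc_rel N = {(f, g). (monom 1 N - 1) dvd (f - g)}"

definition cyc_class :: "nat \<Rightarrow> 'a::comm_ring_1 poly \<Rightarrow> 'a poly set" where
  "cyc_class N f = cyc_rel N `` {f}"

text \<open>As \<open>x\<^sup>N - 1\<close> is monic of degree \<open>N \<ge> 1\<close>, every class has exactly one representative
  \<open>a 0 + a 1 x + \<dots> + a (N - 1) x\<^bsup>N - 1\<^esup>\<close>, so the choice of \<open>a\<close> below is no choice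
  (the values \<open>a i\<close> with \<open>i \<ge> N\<close> are irrelevant).\<close>

definition coterm :: "nat \<Rightarrow> 'a::comm_ring_1 poly set \<Rightarrow> bool" where
  "coterm N A \<longleftrightarrow> N \<ge> 1 \<and>
     (\<exists>a :: nat \<Rightarrow> 'a. A = cyc_class N (\<Sum>i<N. monom (a i) i) \<and>
        (\<forall>i. 1 \<le> i \<and> i \<le> N div 2 \<longrightarrow> a i = a (N - i)))"

text \<open>The sums over all \<open>j \<ge> 0\<close> are cut off at \<open>j = n\<close>: for \<open>j > n\<close> both binomial
  coefficients vanish.\<close>

definition f_n1 :: "nat \<Rightarrow> 'a::comm_ring_1 poly" where
  "f_n1 n = (\<Sum>j\<le>n. smult (of_nat ((n - 1) choose (2 * j + 1))) (monom 1 j - monom 1 (j + 1)))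
          + smult 2 (\<Sum>j\<le>n. smult (of_nat (n choose (2 * j))) (monom 1 j))"

definition C_n :: "nat \<Rightarrow> 'a::comm_ring_1 poly" where
  "C_n n = f_n1 n - smult (of_nat (n + 1)) (monom 1 ((n - 1) div 2))"

end

theory Submission
  imports Defs
begin

text \<open>For odd \<open>n\<close>, Pascal's rule collapses the coefficient of \<open>x\<^sup>j\<close> in \<open>f_n1 n\<close> to
  \<open>(n + 1) choose (2 * j + 1)\<close>, which is symmetric under \<open>j \<mapsto> (n - 1) / 2 - j\<close>. Its end
  terms are both \<open>n + 1\<close>, so the subtraction in \<open>C_n n\<close> removes exactly the term of degree
  \<open>(n - 1) / 2\<close> and leaves the reduced representative.\<close>

lemma coeff_f_n1:
  assumes "odd n"
  shows "coeff (f_n1 n :: 'a::comm_ring_1 poly) k = of_nat (Suc n choose (2 * k + 1))"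
proof -
  obtain m where n: "n = Suc m"
    using assms by (cases n) auto
  have plain: "coeff (\<Sum>j\<le>n. smult (c j) (monom 1 j)) k = c k"
    if "\<And>j. j > n \<Longrightarrow> c j = 0" for c :: "nat \<Rightarrow> 'a" and k
  proof -
    have "coeff (\<Sum>j\<le>n. smult (c j) (monom 1 j)) k = (\<Sum>j\<le>n. if j = k then c j else 0)"
      unfolding coeff_sum by (intro sum.cong) auto
    then show ?thesis
      using that by (simp add: not_le)
  qed
  \<comment> \<open>Multiplication by x as \<open>pCons 0\<close>: the coefficient at k becomes the
    one at k - 1, and 0 at k = 0.\<close>
  have shift: "(\<Sum>j\<le>n. smult (c j) (monom 1 (j + 1))) = pCons 0 (\<Sum>j\<le>n. smult (c j) (monom 1 j))"
    for c :: "nat \<Rightarrow> 'a"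
    by (rule poly_eqI) (auto simp: coeff_sum coeff_pCons split: nat.split)
  have plain_odd: "coeff (\<Sum>j\<le>n. smult (of_nat (n - 1 choose (2 * j + 1))) (monom 1 j)) k =
      (of_nat (n - 1 choose (2 * k + 1)) :: 'a)" for k
    by (rule plain) (simp add: binomial_eq_0)
  have plain_even: "coeff (\<Sum>j\<le>n. smult (of_nat (n choose (2 * j))) (monom 1 j)) k =
      (of_nat (n choose (2 * k)) :: 'a)" for k
    by (rule plain) (simp add: binomial_eq_0)
  have coeff_eq: "coeff (f_n1 n :: 'a poly) k = of_nat (n - 1 choose (2 * k + 1))
      - coeff (pCons 0 (\<Sum>j\<le>n. smult (of_nat (n - 1 choose (2 * j + 1))) (monom 1 j))) k
      + 2 * of_nat (n choose (2 * k))"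
    unfolding f_n1_def smult_diff_right sum_subtractf shift coeff_add coeff_diff coeff_smult
      plain_odd plain_even ..
  show ?thesis
  proof (cases k)
    \<comment> \<open>No shifted term here: (n - 1) + 2 = n + 1.\<close>
    case 0
    then show ?thesis
      unfolding coeff_eq by (simp add: n)
  next
    case (Suc l)
    have "coeff (f_n1 n :: 'a poly) k = of_nat (m choose (2 * k + 1))
        - of_nat (m choose (2 * l + 1)) + 2 * of_nat (Suc m choose (2 * k))"
      unfolding coeff_eq unfolding Suc coeff_pCons_Suc plain_odd by (simp only: n diff_Suc_1)
    \<comment> \<open>Here 2l + 1 = 2k - 1. Splitting \<open>Suc m choose (2 * k)\<close> turns the
      sum into C(m,2k+1) + 2 C(m,2k) + C(m,2k-1), which is Pascal's rule applied twice to
      C(m+2,2k+1).\<close>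
    also have "\<dots> = of_nat (Suc n choose (2 * k + 1))"
      unfolding n by (simp add: Suc algebra_simps)
    finally show ?thesis .
  qed
qed

text \<open>An identity of polynomials, not merely modulo x^N - 1, so its coefficients can serve
  directly as the witness in \<open>coterm\<close>.\<close>

lemma C_n_eq_sum:
  assumes "n = 2 * N + 1"
  shows "(C_n n :: 'a::comm_ring_1 poly) =
    (\<Sum>i<N. monom (of_nat ((n + 1) choose (2 * i + 1))) i)"
proof (rule poly_eqI)
  fix k
  let ?c = "\<lambda>i. of_nat ((n + 1) choose (2 * i + 1)) :: 'a"
  have "odd n" and half: "(n - 1) div 2 = N"
    using assms by simp_all
  have lhs: "coeff (C_n n :: 'a poly) k = ?c k - (if k = N then of_nat (n + 1) else 0)"
    unfolding C_n_def coeff_diff coeff_f_n1[OF \<open>odd n\<close>] half by simp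
  have rhs: "coeff (\<Sum>i<N. monom (?c i) i) k = (if k < N then ?c k else 0)"
    by (simp add: coeff_sum)
  have "?c N = of_nat (n + 1)"
    unfolding assms by (simp del: binomial_Suc_Suc)
  \<comment> \<open>For k > N the lower index 2k + 1 is at least n + 2.\<close>
  moreover have "?c k = 0" if "k > N"
    using that assms by (simp add: binomial_eq_0 del: binomial_Suc_Suc)
  ultimately show "coeff (C_n n :: 'a poly) k = coeff (\<Sum>i<N. monom (?c i) i) k"
    unfolding lhs rhs by (cases k N rule: linorder_cases) (simp_all del: binomial_Suc_Suc)
qed

theorem theorem5p11:
  fixes p n N :: nat
  assumes "p = CARD('p::prime_card)"
    and "prime p" and "odd p"
    and "n > 3" and "odd n"
    and "\<And>l1 :: nat. l1 > 0 \<Longrightarrow> n + 1 \<noteq> 2 * l1 * p"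
    and "\<And>l2 :: nat. l2 > 0 \<Longrightarrow> n \<noteq> p ^ l2"
    and "N = (n - 1) div 2"
  shows "coterm N (cyc_class N (C_n n :: 'p mod_ring poly))"
proof -
  have n: "n = 2 * N + 1"
    using assms(5,8) by (auto elim: oddE)
  let ?a = "\<lambda>i. of_nat ((n + 1) choose (2 * i + 1)) :: 'p mod_ring"
  have sym: "?a i = ?a (N - i)" if "i \<le> N div 2" for i
  proof -
    \<comment> \<open>As n + 1 = 2N + 2 is even, complementation preserves odd lower indices; i
      \<le> N makes N - i a true difference.\<close>
    have "2 * i + 1 \<le> n + 1" and "n + 1 - (2 * i + 1) = 2 * (N - i) + 1"
      using that n by linarith+
    then show ?thesis
      using binomial_symmetric[of "2 * i + 1" "n + 1"] by (simp only:)
  qed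
  show ?thesis
    unfolding coterm_def C_n_eq_sum[OF n]
  proof (intro conjI exI[of _ ?a] allI impI refl)
    show "1 \<le> N"
      using assms(4) n by linarith
  qed (rule sym, erule conjunct2)
qed

end
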